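(* There is no infinite sequence $(\mathcal D_Y^{(1)},\mathcal D_N^{(1)}),(\mathcal D_Y^{(2)},\mathcal D_N^{(2)}),\dots$ of padded one-wise pairs with $\mathcal D_N^{(t)},\mathcal D_Y^{(t)}\in\Delta_3$ for all $t$ such that $$\lim_{t\to\infty}\frac{\beta_{\{3\}}(\mathcal D_N^{(t)})}{\gamma_{\{3\}}(\mathcal D_Y^{(t)})}=\frac29.$$
   Context: For a distribution $\mathcal D$ on $\mathbb Z_2^3$, $\mathcal D$ is symmetric if strings of equal Hamming weight have equal probability; $\Delta_3$ is the set of symmetric distributions on $\mathbb Z_2^3$. $\mathcal B_p$ gives $0$ probability $p$ and $1$ probability $1-p$. With $3\mathrm{AND}(\mathbf a)=a_1a_2a_3$: $\lambda_{\{3\}}(\mathcal D,p)=\mathbb E_{\mathbf b\sim\mathcal D,\mathbf a\sim\mathcal B_p^3}[3\mathrm{AND}(\mathbf a+\mathbf b)]$, $\gamma_{\{3\}}(\mathcal D)=\lambda_{\{3\}}(\mathcal D,1)$, $\beta_{\{3\}}(\mathcal D)=\sup_{p\in[0,1]}\lambda_{\{3\}}(\mathcal D,p)$ (a ratio with zero denominator is $+\infty$). A distribution $\mathcal D$ on $\mathbb Z_2^3$ has uniform marginals if $\mathbb E_{\mathbf a\sim\mathcal D}[(-1)^{a_i}]=0$ for each $i$. A pair $(\mathcal D_N,\mathcal D_Y)$ is a padded one-wise pair if there exist $\eta\in[0,1]$ and distributions $\mathcal D_0,\mathcal D_N',\mathcal D_Y'$ on $\mathbb Z_2^3$, with $\mathcal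 D_N',\mathcal D_Y'$ having uniform marginals, such that $\mathcal D_N=\eta\mathcal D_0+(1-\eta)\mathcal D_N'$ and $\mathcal D_Y=\eta\mathcal D_0+(1-\eta)\mathcal D_Y'$. *)

theory Defs
  imports "HOL-Probability.Probability" "HOL-Library.Z2"
begin

text \<open>
  Strings in \<open>\<int>\<^sub>2\<^sup>3\<close> are vectors of type \<open>bit ^ 3\<close>, with componentwise addition in the
  two-element field; a distribution on \<open>\<int>\<^sub>2\<^sup>3\<close> is a \<open>(bit ^ 3) pmf\<close>.
\<close>

definition hamming_weight :: "bit ^ 3 \<Rightarrow> nat" where
  "hamming_weight x = card {i. x $ i \<noteq> 0}"

definition symmetric_dists :: "(bit ^ 3) pmf set"  (\<open>\<Delta>\<^sub>3\<close>) where
  "\<Delta>\<^sub>3 = {D. \<forall>x y. hamming_weight x = hamming_weight y \<longrightarrow> pmf D x = pmf D y}"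

text \<open>
  \<open>bit_bernoulli p\<close> gives 0 (not 1) probability \<open>p\<close>. It is only meaningful for
  \<open>p \<in> {0..1}\<close>, since \<open>bernoulli_pmf\<close> clamps its parameter to that interval.
\<close>

definition bit_bernoulli :: "real \<Rightarrow> bit pmf" where
  "bit_bernoulli p = map_pmf (\<lambda>c. if c then 0 else 1) (bernoulli_pmf p)"

definition bit_bernoulli3 :: "real \<Rightarrow> (bit ^ 3) pmf" where
  "bit_bernoulli3 p = map_pmf (\<lambda>f. \<chi> i. f i) (Pi_pmf UNIV 0 (\<lambda>_::3. bit_bernoulli p))"

definition and3 :: "bit ^ 3 \<Rightarrow> bit" where
  "and3 a = a $ 1 * a $ 2 * a $ 3"

definition and3_lambda :: "(bit ^ 3) pmf \<Rightarrow> real \<Rightarrow> real" where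
  "and3_lambda D p =
     measure_pmf.expectation (pair_pmf D (bit_bernoulli3 p)) (\<lambda>(b, a). of_bit (and3 (a + b)))"

definition and3_gamma :: "(bit ^ 3) pmf \<Rightarrow> real" where
  "and3_gamma D = and3_lambda D 1"

definition and3_beta :: "(bit ^ 3) pmf \<Rightarrow> real" where
  "and3_beta D = (SUP p\<in>{0..1}. and3_lambda D p)"

text \<open>
  Division with \<open>x / 0 = \<infinity>\<close> for every \<open>x\<close>; the built-in division of \<open>ereal\<close> has
  \<open>0 / 0 = 0\<close>.
\<close>

definition ratio :: "real \<Rightarrow> real \<Rightarrow> ereal" where
  "ratio x y = (if y = 0 then \<infinity> else ereal (x / y))"

definition uniform_marginals :: "(bit ^ 3) pmf \<Rightarrow> bool" where
  "uniform_marginals D \<longleftrightarrow>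
     (\<forall>i. measure_pmf.expectation D (\<lambda>a. (- 1 :: real) ^ of_bit (a $ i)) = 0)"

text \<open>The first argument is \<open>D\<^sub>N\<close>, the second \<open>D\<^sub>Y\<close>.\<close>

definition padded_one_wise_pair :: "(bit ^ 3) pmf \<Rightarrow> (bit ^ 3) pmf \<Rightarrow> bool" where
  "padded_one_wise_pair DN DY \<longleftrightarrow>
     (\<exists>\<eta>\<in>{0..1}. \<exists>D0 DN' DY'.
        uniform_marginals DN' \<and> uniform_marginals DY' \<and>
        (\<forall>x. pmf DN x = \<eta> * pmf D0 x + (1 - \<eta>) * pmf DN' x) \<and>
        (\<forall>x. pmf DY x = \<eta> * pmf D0 x + (1 - \<eta>) * pmf DY' x))"

end

theory Submission
  imports Defs
begin

text \<open>
  Write \<open>\<gamma>\<close> for the mass that \<open>D\<^sub>Y\<close> gives to the string \<open>111\<close>.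
  The bias \<open>p = 1/2\<close> gives \<open>\<beta> \<ge> 1/8\<close> for every \<open>D\<^sub>N\<close>. At \<open>p = 2/3\<close> a string of weight \<open>w\<close>
  contributes \<open>2^w/27 \<ge> 2w/27\<close>, so the part of \<open>D\<^sub>N\<close> with uniform marginals contributes at least
  \<open>1/9\<close>, while a shared string contributes \<open>8/27\<close> if it is \<open>111\<close> and at least \<open>1/27\<close> otherwise.
  Since a distribution with uniform marginals gives \<open>111\<close> mass at most \<open>1/2\<close>, this yields
  \<open>27\<beta> \<ge> 6\<gamma> + \<eta>\<close> and \<open>2\<gamma> \<le> 1 + \<eta>\<close>. Together with \<open>8\<beta> \<ge> 1\<close> these inequalities force
  \<open>\<beta> \<ge> (8/35)\<gamma>\<close>, and \<open>8/35 > 2/9\<close>.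
\<close>

text \<open>This makes \<open>bit ^ 3\<close> a finite type, so expectations over it become finite
  sums.\<close>

instance bit :: finite
proof
  have "(UNIV :: bit set) = {0, 1}"
    using bit_not_zero_iff by blast
  then show "finite (UNIV :: bit set)"
    by (metis finite.emptyI finite.insertI)
qed

lemma prod_UNIV_3: "prod f (UNIV :: 3 set) = f 1 * f 2 * f 3"
  unfolding UNIV_3 by (simp add: ac_simps)

lemma expectation_finite_type:
  fixes f :: "'a::finite \<Rightarrow> real"
  shows "measure_pmf.expectation D f = (\<Sum>x\<in>UNIV. f x * pmf D x)"
  by (rule integral_measure_pmf_real) auto

lemma expectation_mono_finite_type:
  fixes f g :: "'a::finite \<Rightarrow> real"
  assumes "\<And>x. f x \<le> g x"
  shows "measure_pmf.expectation D f \<le> measure_pmf.expectation D g"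
  unfolding expectation_finite_type by (intro sum_mono mult_right_mono assms) auto

lemma expectation_mixture:
  fixes f :: "'a::finite \<Rightarrow> real"
  assumes "\<And>x. pmf D x = \<eta> * pmf D1 x + (1 - \<eta>) * pmf D2 x"
  shows "measure_pmf.expectation D f =
    \<eta> * measure_pmf.expectation D1 f + (1 - \<eta>) * measure_pmf.expectation D2 f"
  unfolding expectation_finite_type assms
  by (simp add: sum_distrib_left algebra_simps flip: sum.distrib)

lemma pmf_bit_bernoulli:
  assumes "p \<in> {0..1}"
  shows "pmf (bit_bernoulli p) c = (if c = 0 then p else 1 - p)"
proof -
  have inj: "inj (\<lambda>c. if c then 0 else (1 :: bit))"
    by (auto simp: inj_on_def split: if_splits)
  show ?thesis
    using pmf_map_inj'[OF inj, of "bernoulli_pmf p" "c = 0"] assms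
    by (cases c) (auto simp: bit_bernoulli_def)
qed

lemma pmf_bit_bernoulli3:
  assumes "p \<in> {0..1}"
  shows "pmf (bit_bernoulli3 p) a = (\<Prod>i\<in>UNIV. if a $ i = 0 then p else 1 - p)"
proof -
  have inj: "inj (\<lambda>f. \<chi> i. f i :: bit ^ 3)"
    by (auto simp: inj_on_def vec_eq_iff)
  show ?thesis
    using pmf_map_inj'[OF inj, of "Pi_pmf UNIV 0 (\<lambda>_::3. bit_bernoulli p)" "($) a"]
    by (simp add: bit_bernoulli3_def pmf_Pi pmf_bit_bernoulli[OF assms])
qed

text \<open>3AND is nonzero only at the all-ones vector \<open>1\<close>, and in characteristic two
  adding \<open>b\<close> is its own inverse.\<close>

lemma of_bit_and3_add:
  "(of_bit (and3 (a + b)) :: real) = (if a = b + 1 then 1 else 0)"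
proof -
  have "x + y = 1 \<longleftrightarrow> x = y + 1" for x y :: bit
    by (cases x; cases y) simp_all
  then have "and3 (a + b) = 1 \<longleftrightarrow> a = b + 1"
    by (auto simp: and3_def vec_eq_iff forall_3)
  then show ?thesis
    by (cases "and3 (a + b)") auto
qed

text \<open>For fixed \<open>b\<close> only the complement \<open>a = b + 1\<close> contributes.
  Complementing swaps the roles of \<open>p\<close> and \<open>1 - p\<close>.\<close>

lemma and3_lambda_eq:
  assumes "p \<in> {0..1}"
  shows "and3_lambda D p =
    measure_pmf.expectation D (\<lambda>b. \<Prod>i\<in>UNIV. if b $ i = 0 then 1 - p else p)"
proof -
  have flip: "((b + 1) $ i = 0) = (b $ i \<noteq> 0)" for b :: "bit ^ 3" and i
    by (cases "b $ i") simp_all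
  have "and3_lambda D p = (\<Sum>(b, a)\<in>UNIV \<times> UNIV. 
      (if a = b + 1 then 1 else 0) * (pmf D b * pmf (bit_bernoulli3 p) a))"
    unfolding and3_lambda_def expectation_finite_type UNIV_Times_UNIV
    by (rule sum.cong) (simp_all only: split_paired_all prod.case pmf_pair of_bit_and3_add)
  also have "\<dots> = (\<Sum>b\<in>UNIV. \<Sum>a\<in>UNIV.
      if a = b + 1 then pmf D b * pmf (bit_bernoulli3 p) a else 0)"
    by (subst sum.cartesian_product[symmetric]) (intro sum.cong refl, auto)
  also have "\<dots> = (\<Sum>b\<in>UNIV. pmf D b * pmf (bit_bernoulli3 p) (b + 1))"
    by simp
  also have "\<dots> = (\<Sum>b\<in>UNIV. (\<Prod>i\<in>UNIV. if b $ i = 0 then 1 - p else p) * pmf D b)"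
    unfolding pmf_bit_bernoulli3[OF assms] flip
    by (intro sum.cong refl) (auto intro!: prod.cong)
  finally show ?thesis
    by (simp add: expectation_finite_type)
qed

lemma and3_gamma_eq: "and3_gamma D = pmf D 1"
proof -
  \<comment> \<open>At \<open>p = 1\<close> a single zero bit kills the product.\<close>
  have "(\<Prod>i\<in>UNIV. if b $ i = 0 then 1 - 1 else 1 :: real) = indicator {1} b" for b :: "bit ^ 3"
    by (auto simp: vec_eq_iff indicator_def prod_zero_iff)
  then show ?thesis
    by (simp add: and3_gamma_def and3_lambda_eq measure_pmf_single)
qed

lemma and3_lambda_le_beta:
  assumes "p \<in> {0..1}"
  shows "and3_lambda D p \<le> and3_beta D"
  unfolding and3_beta_def
proof (rule cSUP_upper[OF assms])
  \<comment> \<open>A real supremum dominates its members only once the family is known to be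
    bounded above.\<close>
  have "and3_lambda D q \<le> 1" for q
    using expectation_mono_finite_type
      [of "\<lambda>(b, a). of_bit (and3 (a + b))" "\<lambda>_. 1" "pair_pmf D (bit_bernoulli3 q)"]
    by (auto simp: and3_lambda_def)
  then show "bdd_above (and3_lambda D ` {0..1})"
    by (intro bdd_aboveI2)
qed

lemma and3_beta_ge_eighth: "1 / 8 \<le> and3_beta D"
proof -
  have *: "(\<Prod>i\<in>UNIV. if b $ i = 0 then 1 - 1 / 2 else 1 / 2 :: real) = 1 / 8" for b :: "bit ^ 3"
    by (simp add: prod_UNIV_3)
  have "and3_lambda D (1 / 2) = measure_pmf.expectation D (\<lambda>_. 1 / 8)"
    by (subst and3_lambda_eq) (simp, simp only: *)
  then show ?thesis
    using and3_lambda_le_beta[of "1 / 2" D] by simp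
qed

lemma uniform_marginals_expectation_sum:
  assumes "uniform_marginals D"
  shows "measure_pmf.expectation D (\<lambda>a. \<Sum>i\<in>UNIV. (- 1 :: real) ^ of_bit (a $ i)) = 0"
  using assms unfolding uniform_marginals_def
  by (subst Bochner_Integration.integral_sum) (auto intro: integrable_measure_pmf_finite)

lemma uniform_marginals_pmf_one_le:
  assumes "uniform_marginals D"
  shows "pmf D 1 \<le> 1 / 2"
proof -
  \<comment> \<open>The right-hand integrand is the indicator of the event that the first bit is 1,
    which contains the string 111.\<close>
  have "measure_pmf.expectation D (indicator {1}) \<le>
      measure_pmf.expectation D (\<lambda>a. (1 - (- 1 :: real) ^ of_bit (a $ 1)) / 2)"
    by (rule expectation_mono_finite_type) (auto simp: indicator_def)
  also have "\<dots> = 1 / 2"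
    using assms unfolding uniform_marginals_def
    by (simp add: integrable_measure_pmf_finite)
  finally show ?thesis
    by (simp add: measure_pmf_single)
qed

text \<open>The right-hand side is \<open>2w\<close> for a string of weight \<open>w\<close>, the line through
  \<open>2^w\<close> at \<open>w = 1\<close> and \<open>w = 2\<close>.\<close>

lemma biased_weight_ge_linear:
  fixes b :: "bit ^ 3"
  shows "27 * (\<Prod>i\<in>UNIV. if b $ i = 0 then 1 - 2 / 3 else 2 / 3) \<ge>
    3 - (\<Sum>i\<in>UNIV. (- 1 :: real) ^ of_bit (b $ i))"
  unfolding sum_3 prod_UNIV_3 by (cases "b $ 1"; cases "b $ 2"; cases "b $ 3") simp_all

text \<open>For weight w the left-hand side is 2^w, which is 8 at 111 and at least 1
  elsewhere.\<close>

lemma biased_weight_ge_indicator: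
  fixes b :: "bit ^ 3"
  shows "27 * (\<Prod>i\<in>UNIV. if b $ i = 0 then 1 - 2 / 3 else 2 / 3 :: real) \<ge>
    1 + 7 * indicator {1} b"
  unfolding prod_UNIV_3
  by (cases "b $ 1"; cases "b $ 2"; cases "b $ 3")
    (simp_all add: indicator_def vec_eq_iff forall_3)

lemma and3_lambda_two_thirds_ge:
  "27 * and3_lambda D (2 / 3) \<ge> 1 + 7 * pmf D 1"
proof -
  have "1 + 7 * pmf D 1 = measure_pmf.expectation D (\<lambda>b. 1 + 7 * indicator {1} b)"
    by (simp add: integrable_measure_pmf_finite measure_pmf_single)
  also have "\<dots> \<le> measure_pmf.expectation D
      (\<lambda>b. 27 * (\<Prod>i\<in>UNIV. if b $ i = 0 then 1 - 2 / 3 else 2 / 3))"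
    by (rule expectation_mono_finite_type) (rule biased_weight_ge_indicator)
  finally show ?thesis
    by (simp add: and3_lambda_eq)
qed

text \<open>Uniform marginals annihilate the sum of signs in the linear lower bound, leaving its
  constant term 3.\<close>

lemma uniform_marginals_and3_lambda_two_thirds_ge:
  assumes "uniform_marginals D"
  shows "27 * and3_lambda D (2 / 3) \<ge> 3"
proof -
  have "3 = measure_pmf.expectation D (\<lambda>b. 3 - (\<Sum>i\<in>UNIV. (- 1 :: real) ^ of_bit (b $ i)))"
    using uniform_marginals_expectation_sum[OF assms]
    by (subst Bochner_Integration.integral_diff) (auto intro: integrable_measure_pmf_finite)
  also have "\<dots> \<le> measure_pmf.expectation D
      (\<lambda>b. 27 * (\<Prod>i\<in>UNIV. if b $ i = 0 then 1 - 2 / 3 else 2 / 3))"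
    by (rule expectation_mono_finite_type) (rule biased_weight_ge_linear)
  finally show ?thesis
    by (simp add: and3_lambda_eq)
qed

lemma padded_one_wise_pair_beta_ge:
  assumes "padded_one_wise_pair DN DY"
  shows "and3_beta DN \<ge> 8 / 35 * and3_gamma DY"
proof -
  obtain \<eta> D0 DN' DY' where "\<eta> \<in> {0..1}"
    and unif: "uniform_marginals DN'" "uniform_marginals DY'"
    and DN: "\<And>x. pmf DN x = \<eta> * pmf D0 x + (1 - \<eta>) * pmf DN' x"
    and DY: "\<And>x. pmf DY x = \<eta> * pmf D0 x + (1 - \<eta>) * pmf DY' x"
    using assms unfolding padded_one_wise_pair_def by blast
  then have \<eta>: "0 \<le> \<eta>" "\<eta> \<le> 1"
    by auto
  \<comment> \<open>The mass at 111 that the shared padding gives to both \<open>DN\<close> and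
    \<open>DY\<close>.\<close>
  define e where "e = \<eta> * pmf D0 1"
  have e: "0 \<le> e" "e \<le> \<eta>"
    using \<eta> by (auto simp: e_def pmf_le_1 mult_left_le)
  have \<gamma>: "and3_gamma DY \<le> e + (1 - \<eta>) / 2"
    using mult_left_mono[OF uniform_marginals_pmf_one_le[OF unif(2)], of "1 - \<eta>"] \<eta>
    by (simp add: and3_gamma_eq DY e_def)
  have "27 * and3_lambda DN (2 / 3) =
      \<eta> * (27 * and3_lambda D0 (2 / 3)) + (1 - \<eta>) * (27 * and3_lambda DN' (2 / 3))"
    using expectation_mixture[OF DN] by (simp add: and3_lambda_eq)
  also have "\<dots> \<ge> \<eta> * (1 + 7 * pmf D0 1) + (1 - \<eta>) * 3"
    using \<eta> unif
    by (intro add_mono mult_left_mono and3_lambda_two_thirds_ge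
        uniform_marginals_and3_lambda_two_thirds_ge) auto
  finally have "27 * and3_lambda DN (2 / 3) \<ge> \<eta> + 7 * e + (1 - \<eta>) * 3"
    by (simp add: e_def algebra_simps)
  then have "27 * and3_beta DN \<ge> \<eta> + 7 * e + (1 - \<eta>) * 3"
    using and3_lambda_le_beta[of "2 / 3" DN] by simp
  then show ?thesis
    \<comment> \<open>Adding 8\<beta> \<ge> 1 to the last bound gives 35\<beta> \<ge> 4 - 2\<eta> +
      7e, while 8\<gamma> \<le> 4 - 4\<eta> + 8e. The gap 2\<eta> - e is nonnegative since 0 \<le> e
      \<le> \<eta>.\<close>
    using and3_beta_ge_eighth[of DN] \<gamma> e by argo
qed

lemma padded_one_wise_pair_ratio_ge:
  assumes "padded_one_wise_pair DN DY"
  shows "ratio (and3_beta DN) (and3_gamma DY) \<ge> ereal (8 / 35)"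
proof (cases "and3_gamma DY = 0")
  case False
  then have "and3_gamma DY > 0"
    by (simp add: and3_gamma_eq pmf_pos)
  then show ?thesis
    using padded_one_wise_pair_beta_ge[OF assms] by (simp add: ratio_def pos_le_divide_eq)
qed (simp add: ratio_def)

theorem theorem7p8:
  shows "\<not> (\<exists>(DY :: nat \<Rightarrow> (bit ^ 3) pmf) (DN :: nat \<Rightarrow> (bit ^ 3) pmf).
           (\<forall>t. padded_one_wise_pair (DN t) (DY t) \<and> DN t \<in> \<Delta>\<^sub>3 \<and> DY t \<in> \<Delta>\<^sub>3) \<and>
           (\<lambda>t. ratio (and3_beta (DN t)) (and3_gamma (DY t))) \<longlonglongrightarrow> ereal (2 / 9))"
proof clarify
  fix DY DN :: "nat \<Rightarrow> (bit ^ 3) pmf"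
  assume pairs: "\<forall>t. padded_one_wise_pair (DN t) (DY t) \<and> DN t \<in> \<Delta>\<^sub>3 \<and> DY t \<in> \<Delta>\<^sub>3"
    and lim: "(\<lambda>t. ratio (and3_beta (DN t)) (and3_gamma (DY t))) \<longlonglongrightarrow> ereal (2 / 9)"
  \<comment> \<open>The uniform lower bound passes to the limit, but 8 * 9 = 72 exceeds 2 * 35 =
    70.\<close>
  have "ereal (8 / 35) \<le> ereal (2 / 9)"
    using pairs by (intro LIMSEQ_le_const[OF lim]) (auto intro: padded_one_wise_pair_ratio_ge)
  then show False
    by simp
qed

end
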